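(* Let $\mathcal{C}$ be a simple closed curve of class $C^2$ on the unit sphere $\mathcal{S}\subset\mathbb{R}^3$, and let $\sigma:\mathcal{C}\to\mathbb{R}$ be continuous. Let $(\widetilde V\sigma)(x)=\int_{\mathcal{C}}U^*(x,y)\,\sigma(y)\,ds_y$ for $x\in\mathcal{S}\setminus\mathcal{C}$ be the single layer potential with density $\sigma$. Then for every $x_0\in\mathcal{C}$, $$(V\sigma)(x_0):=\lim_{\mathcal{S}\ni\tilde x\to x_0}(\widetilde V\sigma)(\tilde x)=\int_{\mathcal{C}}U^*(x_0,y)\,\sigma(y)\,ds_y,$$ where the right-hand side exists as a weakly singular line integral. Hence $\widetilde V\sigma$ is continuous across $\mathcal{C}$.
   Context: $\mathcal{S}$ is the unit sphere in $\mathbb{R}^3$; $ds$ is arc length on $\mathcal{C}$. The fundamental solution of the Laplace–Beltrami operator on $\mathcal{S}$ is $U^*(x,y)=-\frac{1}{4\pi}\log|1-(x,y)|$ for $x\neq y$ in $\mathcal{S}$, where $(\cdot,\cdot)$ is the Euclidean inner product of $\mathbb{R}^3$. In the limit, $\tilde x$ ranges over points of $\mathcal{S}\setminus\mathcal{C}$ (approaching $x_0$ from either side of $\mathcal{C}$). *)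

theory Defs
  imports "HOL-Analysis.Analysis"
begin

(* A regular parametrization of period 1 whose restriction to {0..1} is a simple loop.
   Requiring smoothness on the whole line, together with periodicity, makes the curve C^2 also
   at the point where the loop closes up. *)
definition C2_simple_closed_param :: "(real \<Rightarrow> real ^ 3) \<Rightarrow> (real ^ 3) set \<Rightarrow> bool" where
  "C2_simple_closed_param \<gamma> C \<longleftrightarrow>
     simple_path \<gamma> \<and> path_image \<gamma> = C \<and> (\<forall>t. \<gamma> (t + 1) = \<gamma> t) \<and>
     \<gamma> C1_differentiable_on UNIV \<and>
     (\<lambda>t. vector_derivative \<gamma> (at t)) C1_differentiable_on UNIV \<and>
     (\<forall>t. vector_derivative \<gamma> (at t) \<noteq> 0)"

(* Line integrals with respect to arc length over the part of the curve lying in A.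
   The integrand is only evaluated on the curve. *)
definition curve_integrable ::
    "(real \<Rightarrow> real ^ 3) \<Rightarrow> (real ^ 3) set \<Rightarrow> (real ^ 3 \<Rightarrow> real) \<Rightarrow> bool" where
  "curve_integrable \<gamma> A f \<longleftrightarrow>
     (\<lambda>t. f (\<gamma> t) * norm (vector_derivative \<gamma> (at t)))
       absolutely_integrable_on {t \<in> {0..1}. \<gamma> t \<in> A}"

definition curve_integral ::
    "(real \<Rightarrow> real ^ 3) \<Rightarrow> (real ^ 3) set \<Rightarrow> (real ^ 3 \<Rightarrow> real) \<Rightarrow> real" where
  "curve_integral \<gamma> A f =
     integral {t \<in> {0..1}. \<gamma> t \<in> A} (\<lambda>t. f (\<gamma> t) * norm (vector_derivative \<gamma> (at t)))"

(* On the diagonal of the sphere this takes the junk value 0, as ln 0 = 0; in line integrals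
   over a simple curve the diagonal contributes only a null set of parameters. *)
definition U_star :: "real ^ 3 \<Rightarrow> real ^ 3 \<Rightarrow> real" where
  "U_star x y = - (1 / (4 * pi)) * ln \<bar>1 - x \<bullet> y\<bar>"

definition single_layer :: "(real \<Rightarrow> real ^ 3) \<Rightarrow> (real ^ 3 \<Rightarrow> real) \<Rightarrow> real ^ 3 \<Rightarrow> real" where
  "single_layer \<gamma> \<sigma> x = curve_integral \<gamma> (path_image \<gamma>) (\<lambda>y. U_star x y * \<sigma> y)"

(* Lim is unspecified if the limit fails to exist, so convergence has to be asserted separately. *)
definition single_layer_trace ::
    "(real \<Rightarrow> real ^ 3) \<Rightarrow> (real ^ 3 \<Rightarrow> real) \<Rightarrow> real ^ 3 \<Rightarrow> real" where
  "single_layer_trace \<gamma> \<sigma> x0 =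
     Lim (at x0 within sphere 0 1 - path_image \<gamma>) (single_layer \<gamma> \<sigma>)"

end

theory Submission
  imports Defs
begin

text \<open>
  On the sphere \<open>1 - x \<bullet> y = |x - y|^2 / 2\<close>, so the kernel is logarithmic in \<open>|x - y|\<close>, and
  \<open>|ln a - ln b| \<le> 2 sqrt |a - b| (1 / sqrt a + 1 / sqrt b)\<close>. Hence the potential is even
  Hoelder continuous with exponent \<open>1/2\<close> on the whole sphere, provided that
  \<open>\<integral> |x - \<gamma> t| powr (-1/2) dt\<close> is bounded uniformly in \<open>x\<close>. If \<open>\<gamma> p\<close> is a point of the curve
  nearest to \<open>x\<close>, then \<open>|x - \<gamma> t| \<ge> |\<gamma> p - \<gamma> t| / 2\<close>, and the chord-arc inequality for a regular
  simple closed curve bounds this below by a multiple of the cyclic distance of \<open>p\<close> and \<open>t\<close>.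
\<close>

section \<open>Elementary estimates for the logarithm and the inverse square root\<close>

text \<open>For \<open>a \<le> b\<close> apply \<open>ln z \<le> z - 1\<close> to
  \<open>z = sqrt (b / a)\<close>, which costs a factor 2, and bound \<open>sqrt b - sqrt a\<close>
  by \<open>sqrt (b - a)\<close>. This already gives the term with \<open>1 / sqrt a\<close>; the
  other term only makes the bound symmetric.\<close>

lemma abs_ln_diff_le:
  fixes a b :: real
  assumes "0 < a" "0 < b"
  shows "\<bar>ln a - ln b\<bar> \<le> 2 * sqrt \<bar>a - b\<bar> * (1 / sqrt a + 1 / sqrt b)"
  using assms
proof (induction a b rule: linorder_wlog)
  case (le a b)
  have "sqrt b \<le> sqrt a + sqrt (b - a)"
    using sqrt_add_le_add_sqrt[of a "b - a"] le by simp
  then have "sqrt (b / a) - 1 \<le> sqrt (b - a) / sqrt a"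
    using le divide_right_mono[of "sqrt b" "sqrt a + sqrt (b - a)" "sqrt a"]
    by (simp add: real_sqrt_divide add_divide_distrib)
  moreover have "ln (sqrt (b / a)) \<le> sqrt (b / a) - 1"
    using le by (intro ln_le_minus_one) simp
  moreover have "ln (sqrt (b / a)) = (ln b - ln a) / 2"
    using le by (simp add: ln_sqrt ln_div)
  ultimately have "ln b - ln a \<le> 2 * sqrt (b - a) * (1 / sqrt a)"
    by simp
  also have "\<dots> \<le> 2 * sqrt (b - a) * (1 / sqrt a + 1 / sqrt b)"
    using le by (intro mult_left_mono) auto
  finally show ?case
    using le by simp
next
  case (sym a b)
  then show ?case
    by (simp add: abs_minus_commute add.commute)
qed

text \<open>The range of \<open>p\<close> admits the shifts by -1, 0 and 1 of a parameter in the
  unit interval, so that the bound serves all representatives of a point of the circle.\<close>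

lemma inverse_sqrt_has_integral_bounded:
  fixes p :: real
  assumes "\<bar>p\<bar> \<le> 2"
  obtains I where "((\<lambda>t. 1 / sqrt \<bar>t - p\<bar>) has_integral I) {0..1}" "I \<le> 8"
proof
  define F where "F = (\<lambda>t. 2 * sgn (t - p) * sqrt \<bar>t - p\<bar>)"
  \<comment> \<open>In this form the antiderivative is visibly continuous at \<open>p\<close>, and
    on each side of \<open>p\<close> one of the two roots vanishes.\<close>
  have F: "F = (\<lambda>t. 2 * sqrt (max 0 (t - p)) - 2 * sqrt (max 0 (p - t)))"
    by (auto simp: F_def sgn_if max_def fun_eq_iff)
  have "(F has_vector_derivative 1 / sqrt \<bar>t - p\<bar>) (at t)" if "t \<noteq> p" for t
  proof (cases "p < t")
    case True
    have "((\<lambda>t. 2 * sqrt (t - p)) has_vector_derivative 1 / sqrt \<bar>t - p\<bar>) (at t)"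
      using True by (auto intro!: derivative_eq_intros
          simp: has_real_derivative_iff_has_vector_derivative[symmetric] field_simps)
    moreover have "open {p<..}" by simp
    ultimately show ?thesis
      by (rule has_vector_derivative_transform_within_open) (use True in \<open>auto simp: F\<close>)
  next
    case False
    have "((\<lambda>t. - 2 * sqrt (p - t)) has_vector_derivative 1 / sqrt \<bar>t - p\<bar>) (at t)"
      using False that by (auto intro!: derivative_eq_intros
          simp: has_real_derivative_iff_has_vector_derivative[symmetric] field_simps)
    moreover have "open {..<p}" by simp
    ultimately show ?thesis
      by (rule has_vector_derivative_transform_within_open) (use False that in \<open>auto simp: F\<close>)
  qed
  \<comment> \<open>Continuity of \<open>F\<close> lets the fundamental theorem skip the singular
    point \<open>p\<close>.\<close>
  then show "((\<lambda>t. 1 / sqrt \<bar>t - p\<bar>) has_integral (F 1 - F 0)) {0..1}"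
    by (intro fundamental_theorem_of_calculus_strong[of "{p}"])
       (auto simp: F intro!: continuous_intros)
  \<comment> \<open>Both endpoints lie within distance 3 of \<open>p\<close>; rounding up to the
    square 4 makes each contribute at most 4.\<close>
  have "F 1 \<le> 2 * sqrt 4"
  proof -
    have "sqrt (max 0 (1 - p)) \<le> sqrt 4"
      using assms by (intro real_sqrt_le_mono) auto
    moreover have "sqrt (max 0 (p - 1)) \<ge> 0"
      by simp
    ultimately show ?thesis unfolding F by linarith
  qed
  moreover have "- F 0 \<le> 2 * sqrt 4"
  proof -
    have "sqrt (max 0 (p - 0)) \<le> sqrt 4"
      using assms by (intro real_sqrt_le_mono) auto
    moreover have "sqrt (max 0 (0 - p)) \<ge> 0"
      by simp
    ultimately show ?thesis unfolding F by linarith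
  qed
  ultimately show "F 1 - F 0 \<le> 8"
    by simp
qed

section \<open>The chord-arc inequality for a regular closed curve\<close>

text \<open>By compactness the speed has a minimum \<open>m > 0\<close>, and by uniform continuity
  the velocity varies by less than \<open>m / 2\<close> over parameter distances below
  \<open>d\<close>. The error of the linearization is then at most half of its linear term, which
  leaves \<open>c = m / 2\<close>.\<close>

lemma chord_lower_bound_local:
  fixes \<gamma> :: "real \<Rightarrow> 'a :: real_normed_vector"
  assumes deriv: "\<And>t. (\<gamma> has_vector_derivative \<gamma>' t) (at t)"
    and cont: "continuous_on {a..b} \<gamma>'"
    and regular: "\<And>t. t \<in> {a..b} \<Longrightarrow> \<gamma>' t \<noteq> 0"
  obtains c d where "0 < c" "0 < d"
    "\<And>s t. s \<in> {a..b} \<Longrightarrow> t \<in> {a..b} \<Longrightarrow> \<bar>s - t\<bar> < d \<Longrightarrow> c * \<bar>s - t\<bar> \<le> norm (\<gamma> s - \<gamma> t)"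
proof (cases "a \<le> b")
  case False
  then show ?thesis
    by (intro that[of 1 1]) auto
next
  case True
  have "\<exists>t0\<in>{a..b}. \<forall>t\<in>{a..b}. norm (\<gamma>' t0) \<le> norm (\<gamma>' t)"
    using True cont by (intro continuous_attains_inf) (auto intro!: continuous_intros)
  then obtain m where m: "0 < m" "\<And>t. t \<in> {a..b} \<Longrightarrow> m \<le> norm (\<gamma>' t)"
    using regular by (metis zero_less_norm_iff)
  have "uniformly_continuous_on {a..b} \<gamma>'"
    using cont by (intro compact_uniformly_continuous) auto
  then obtain d where d: "0 < d"
    "\<And>s t. s \<in> {a..b} \<Longrightarrow> t \<in> {a..b} \<Longrightarrow> dist s t < d \<Longrightarrow> dist (\<gamma>' s) (\<gamma>' t) < m / 2"
    unfolding uniformly_continuous_on_def using m(1) by (metis half_gt_zero)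
  show ?thesis
  proof (rule that[of "m / 2" d])
    fix s t assume st: "s \<in> {a..b}" "t \<in> {a..b}" "\<bar>s - t\<bar> < d"
    have "norm (\<gamma> s - \<gamma> t - (s - t) *\<^sub>R \<gamma>' t) \<le> norm (s - t) * (m / 2)"
    proof (rule vector_differentiable_bound_linearization)
      show "(\<gamma> has_vector_derivative \<gamma>' u) (at u within closed_segment t s)" for u
        using deriv by (rule has_vector_derivative_at_within)
      show "norm (\<gamma>' u - \<gamma>' t) \<le> m / 2" if "u \<in> closed_segment t s" for u
      proof -
        have "u \<in> {a..b}" "dist u t < d"
          using that st by (auto simp: closed_segment_eq_real_ivl dist_real_def split: if_splits)
        then show ?thesis
          using d(2)[of u t] st by (simp add: dist_norm)
      qed
    qed auto
    moreover have "norm ((s - t) *\<^sub>R \<gamma>' t) \<ge> \<bar>s - t\<bar> * m"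
      using m(2)[OF st(2)] by (simp add: mult_left_mono)
    moreover have "norm ((s - t) *\<^sub>R \<gamma>' t) \<le> norm (\<gamma> s - \<gamma> t) + norm (\<gamma> s - \<gamma> t - (s - t) *\<^sub>R \<gamma>' t)"
      by (metis norm_triangle_sub norm_minus_commute)
    ultimately show "m / 2 * \<bar>s - t\<bar> \<le> norm (\<gamma> s - \<gamma> t)"
      by (simp add: algebra_simps)
  qed (use m d in auto)
qed

text \<open>Parameters that are close modulo 1 are handled by the local bound, all others by
  compactness and injectivity.\<close>

lemma chord_arc_closed_curve:
  fixes \<gamma> :: "real \<Rightarrow> 'a :: real_normed_vector"
  assumes deriv: "\<And>t. (\<gamma> has_vector_derivative \<gamma>' t) (at t)"
    and cont: "continuous_on UNIV \<gamma>'"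
    and regular: "\<And>t. \<gamma>' t \<noteq> 0"
    and periodic: "\<And>t. \<gamma> (t + 1) = \<gamma> t"
    and simple: "loop_free \<gamma>"
  obtains c where "0 < c"
    "\<And>s t. s \<in> {0..1} \<Longrightarrow> t \<in> {0..1} \<Longrightarrow> c * min \<bar>s - t\<bar> (1 - \<bar>s - t\<bar>) \<le> norm (\<gamma> s - \<gamma> t)"
proof -
  have cont\<gamma>: "continuous_on S \<gamma>" for S
    using deriv by (meson continuous_at_imp_continuous_on has_vector_derivative_continuous)
  \<comment> \<open>The interval has length 2 so that a pair near the closing point can be compared
    after moving \<open>s\<close> to \<open>s + 1\<close>.\<close>
  obtain c d where c: "0 < c" and d: "0 < d" and
    local: "\<And>s t. s \<in> {0..2} \<Longrightarrow> t \<in> {0..2} \<Longrightarrow> \<bar>s - t\<bar> < d \<Longrightarrow> c * \<bar>s - t\<bar> \<le> norm (\<gamma> s - \<gamma> t)"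
    using chord_lower_bound_local[OF deriv continuous_on_subset[OF cont subset_UNIV] regular] by metis
  define K where "K = {(s, t) \<in> {0..1::real} \<times> {0..1}. t - s \<in> {d..1-d}}"
  have "compact K"
  proof -
    have "closed ((\<lambda>p. snd p - fst p) -` {d..1-d})"
      by (intro closed_vimage continuous_intros)
    moreover have "K = ({0..1} \<times> {0..1}) \<inter> (\<lambda>p. snd p - fst p) -` {d..1-d}"
      by (auto simp: K_def)
    ultimately show ?thesis
      by (simp add: compact_Int_closed compact_Times)
  qed
  have "\<exists>e>0. \<forall>(s, t)\<in>K. e \<le> norm (\<gamma> s - \<gamma> t)"
  proof (cases "K = {}")
    case False
    have "continuous_on K (\<lambda>(s, t). norm (\<gamma> s - \<gamma> t))"
      unfolding case_prod_unfold
      by (intro continuous_intros continuous_on_compose2[OF cont\<gamma>[of UNIV]]) auto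
    then obtain p where p: "p \<in> K" "\<forall>q\<in>K. (\<lambda>(s, t). norm (\<gamma> s - \<gamma> t)) p \<le> (\<lambda>(s, t). norm (\<gamma> s - \<gamma> t)) q"
      using continuous_attains_inf[OF \<open>compact K\<close> False] by blast
    obtain s t where st: "p = (s, t)" by fastforce
    \<comment> \<open>Membership in \<open>K\<close> keeps \<open>t - s\<close> away from both 0 and
      1. The value 1 would mean the pair of endpoints, the one coincidence that
      \<open>loop_free\<close> allows.\<close>
    have "\<gamma> s \<noteq> \<gamma> t"
      using simple p(1) d unfolding loop_free_def K_def st by force
    then show ?thesis
      using p st by (intro exI[of _ "norm (\<gamma> s - \<gamma> t)"]) auto
  qed (auto intro: exI[of _ 1])
  then obtain e where e: "0 < e" "\<And>s t. (s, t) \<in> K \<Longrightarrow> e \<le> norm (\<gamma> s - \<gamma> t)"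
    by blast
  have main: "min c e * min (t - s) (1 - (t - s)) \<le> norm (\<gamma> s - \<gamma> t)"
    if "0 \<le> s" "s \<le> t" "t \<le> 1" for s t
  proof -
    have "t - s < d \<or> 1 - (t - s) < d \<or> (s, t) \<in> K"
      using that by (auto simp: K_def)
    then consider "t - s < d" | "1 - (t - s) < d" | "(s, t) \<in> K"
      by blast
    then show ?thesis
    proof cases
      case 1
      have "min c e * min (t - s) (1 - (t - s)) \<le> c * (t - s)"
        using that c e by (intro mult_mono) auto
      also have "\<dots> \<le> norm (\<gamma> s - \<gamma> t)"
        using local[of s t] that 1 by simp
      finally show ?thesis .
    next
      case 2
      \<comment> \<open>Here \<open>s\<close> and \<open>t\<close> are close only across the closing
        point, so the local bound is used for \<open>s + 1\<close> and \<open>t\<close>.\<close>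
      have "min c e * min (t - s) (1 - (t - s)) \<le> c * (1 - (t - s))"
        using that c e by (intro mult_mono) auto
      also have "\<dots> \<le> norm (\<gamma> (s + 1) - \<gamma> t)"
        using local[of "s + 1" t] that 2 by (simp add: algebra_simps)
      finally show ?thesis
        by (simp add: periodic)
    next
      case 3
      have "min c e * min (t - s) (1 - (t - s)) \<le> e * 1"
        using that c e by (intro mult_mono) auto
      then show ?thesis
        using e(2)[OF 3] by simp
    qed
  qed
  show ?thesis
  proof (rule that)
    show "0 < min c e" using c e by simp
    show "min c e * min \<bar>s - t\<bar> (1 - \<bar>s - t\<bar>) \<le> norm (\<gamma> s - \<gamma> t)"
      if "s \<in> {0..1}" "t \<in> {0..1}" for s t
      using main[of s t] main[of t s] that
      by (cases "s \<le> t") (auto simp: norm_minus_commute)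
  qed
qed

section \<open>Uniform bound for the inverse square root of the distance to the curve\<close>

text \<open>The bound does not depend on \<open>x\<close>, on or off the curve, and this makes the
  later estimates uniform. The factor 24 is three times the bound 8 for the one-dimensional
  integral, once for each element of \<open>P\<close>; \<open>2 / c\<close> comes from the chord-arc
  constant halved by the nearest-point argument.\<close>

lemma inverse_sqrt_dist_curve_integral_bounded:
  fixes \<gamma> :: "real \<Rightarrow> 'a :: real_normed_vector"
  assumes cont: "continuous_on {0..1} \<gamma>" and c: "0 < c"
    and chord: "\<And>s t. s \<in> {0..1} \<Longrightarrow> t \<in> {0..1} \<Longrightarrow>
      c * min \<bar>s - t\<bar> (1 - \<bar>s - t\<bar>) \<le> norm (\<gamma> s - \<gamma> t)"
  shows "finite {t \<in> {0..1}. \<gamma> t = x}"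
    and "(\<lambda>t. 1 / sqrt (norm (x - \<gamma> t))) integrable_on {0..1}"
    and "integral {0..1} (\<lambda>t. 1 / sqrt (norm (x - \<gamma> t))) \<le> 24 * sqrt (2 / c)"
proof -
  define f where "f = (\<lambda>t. 1 / sqrt (norm (x - \<gamma> t)))"
  have "\<exists>p\<in>{0..1}. \<forall>t\<in>{0..1}. norm (x - \<gamma> p) \<le> norm (x - \<gamma> t)"
    using cont by (intro continuous_attains_inf) (auto intro!: continuous_intros)
  then obtain p where p: "p \<in> {0..1}" "\<And>t. t \<in> {0..1} \<Longrightarrow> norm (x - \<gamma> p) \<le> norm (x - \<gamma> t)"
    by blast
  \<comment> \<open>For \<open>t\<close> in the unit interval, the cyclic distance of
    \<open>p\<close> and \<open>t\<close> is the ordinary distance from \<open>t\<close> to one of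
    these three points.\<close>
  define P where "P = {p, p - 1, p + 1}"
  have lower: "\<exists>q\<in>P. c / 2 * \<bar>t - q\<bar> \<le> norm (x - \<gamma> t)" if t: "t \<in> {0..1}" for t
  proof -
    \<comment> \<open>By the choice of \<open>p\<close> the right-hand side is at most
      \<open>2 * norm (x - \<gamma> t)\<close>.\<close>
    have "norm (\<gamma> p - \<gamma> t) \<le> norm (x - \<gamma> p) + norm (x - \<gamma> t)"
      using norm_triangle_ineq4[of "x - \<gamma> t" "x - \<gamma> p"] by simp
    then have "c / 2 * min \<bar>p - t\<bar> (1 - \<bar>p - t\<bar>) \<le> norm (x - \<gamma> t)"
      using chord[OF p(1) t] p(2)[OF t] by simp
    moreover have "\<exists>q\<in>P. min \<bar>p - t\<bar> (1 - \<bar>p - t\<bar>) = \<bar>t - q\<bar>"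
      using p(1) t by (auto simp: P_def min_def abs_if)
    ultimately show ?thesis
      by metis
  qed
  have "{t \<in> {0..1}. \<gamma> t = x} \<subseteq> P"
  proof
    fix t assume "t \<in> {t \<in> {0..1}. \<gamma> t = x}"
    then obtain q where "q \<in> P" "c / 2 * \<bar>t - q\<bar> \<le> 0"
      using lower[of t] by auto
    then show "t \<in> P"
      using c by (simp add: mult_le_0_iff)
  qed
  then show "finite {t \<in> {0..1}. \<gamma> t = x}"
    by (rule finite_subset) (simp add: P_def)
  \<comment> \<open>Summing over all of \<open>P\<close> gives a majorant that does not depend on
    which \<open>q\<close> serves a given \<open>t\<close>.\<close>
  define G where "G = (\<lambda>t. sqrt (2 / c) *
    (1 / sqrt \<bar>t - p\<bar> + 1 / sqrt \<bar>t - (p - 1)\<bar> + 1 / sqrt \<bar>t - (p + 1)\<bar>))"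
  obtain I where I: "(G has_integral I) {0..1}" "I \<le> 24 * sqrt (2 / c)"
  proof -
    obtain I0 where I0: "((\<lambda>t. 1 / sqrt \<bar>t - p\<bar>) has_integral I0) {0..1}" "I0 \<le> 8"
      using p by (auto intro: inverse_sqrt_has_integral_bounded[of p])
    obtain I1 where I1: "((\<lambda>t. 1 / sqrt \<bar>t - (p - 1)\<bar>) has_integral I1) {0..1}" "I1 \<le> 8"
      using p by (auto intro: inverse_sqrt_has_integral_bounded[of "p - 1"])
    obtain I2 where I2: "((\<lambda>t. 1 / sqrt \<bar>t - (p + 1)\<bar>) has_integral I2) {0..1}" "I2 \<le> 8"
      using p by (auto intro: inverse_sqrt_has_integral_bounded[of "p + 1"])
    have "(G has_integral sqrt (2 / c) * (I0 + I1 + I2)) {0..1}"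
      unfolding G_def using I0(1) I1(1) I2(1)
      by (intro has_integral_mult_right has_integral_add)
    moreover have "sqrt (2 / c) * (I0 + I1 + I2) \<le> sqrt (2 / c) * 24"
      using I0(2) I1(2) I2(2) c by (intro mult_left_mono) auto
    ultimately show ?thesis
      by (intro that) (auto simp: mult.commute)
  qed
  have fG: "f t \<le> G t" if t: "t \<in> {0..1} - P" for t
  proof -
    obtain q where q: "q \<in> P" "c / 2 * \<bar>t - q\<bar> \<le> norm (x - \<gamma> t)"
      using lower t by auto
    have "0 < c / 2 * \<bar>t - q\<bar>"
      using c q t by (intro mult_pos_pos) auto
    then have "f t \<le> 1 / sqrt (c / 2 * \<bar>t - q\<bar>)"
      unfolding f_def using q by (intro divide_left_mono mult_pos_pos) auto
    also have "\<dots> = sqrt (2 / c) * (1 / sqrt \<bar>t - q\<bar>)"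
      by (simp add: real_sqrt_mult real_sqrt_divide)
    also have "\<dots> \<le> G t"
      unfolding G_def using q(1) c by (intro mult_left_mono) (auto simp: P_def)
    finally show ?thesis .
  qed
  \<comment> \<open>On \<open>P\<close> a summand of \<open>G\<close> takes the default value
    \<open>1 / 0 = 0\<close>, so \<open>G\<close> may fail to dominate \<open>f\<close> there.
    Changing it at finitely many points repairs this and keeps the integral.\<close>
  define G' where "G' = (\<lambda>t. if t \<in> P then f t else G t)"
  have G': "(G' has_integral I) {0..1}"
    by (rule has_integral_spike_finite[OF _ _ I(1), of P]) (auto simp: G'_def P_def)
  have le: "f t \<le> G' t" if "t \<in> {0..1}" for t
    using fG that by (simp add: G'_def)
  have "(\<lambda>t. norm (x - \<gamma> t)) \<in> borel_measurable (lebesgue_on {0..1})"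
    using cont by (intro continuous_imp_measurable_on_sets_lebesgue) (auto intro!: continuous_intros)
  then have "f \<in> borel_measurable (lebesgue_on {0..1})"
    unfolding f_def by measurable
  moreover have "\<bar>f t\<bar> \<le> G' t" if "t \<in> {0..1}" for t
    using le[OF that] by (simp add: f_def)
  ultimately have "f integrable_on {0..1}"
    using G' by (intro measurable_bounded_by_integrable_imp_integrable_real[of f _ G']) auto
  then show "(\<lambda>t. 1 / sqrt (norm (x - \<gamma> t))) integrable_on {0..1}"
    by (simp add: f_def)
  have "integral {0..1} f \<le> I"
    using \<open>f integrable_on {0..1}\<close> G' le by (meson has_integral_le integrable_integral)
  then show "integral {0..1} (\<lambda>t. 1 / sqrt (norm (x - \<gamma> t))) \<le> 24 * sqrt (2 / c)"
    using I(2) by (simp add: f_def)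
qed

section \<open>The kernel on the sphere\<close>

lemma one_minus_inner_sphere:
  fixes x y :: "'a :: real_inner"
  assumes "x \<in> sphere 0 1" "y \<in> sphere 0 1"
  shows "1 - x \<bullet> y = (norm (x - y))\<^sup>2 / 2"
proof -
  have "x \<bullet> x = 1" "y \<bullet> y = 1"
    using assms by (auto simp: dot_square_norm)
  then show ?thesis
    by (simp add: power2_norm_eq_inner algebra_simps inner_commute)
qed

lemma U_star_eq:
  assumes "x \<in> sphere 0 1" "y \<in> sphere 0 1" "x \<noteq> y"
  shows "U_star x y = - (1 / (4 * pi)) * (2 * ln (norm (x - y)) - ln 2)"
  using assms by (simp add: U_star_def one_minus_inner_sphere ln_div ln_realpow)

text \<open>The kernel is \<open>- ln (norm (x - y)) / (2 * pi)\<close> up to an additive constant,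
  which cancels in the difference. Relaxing \<open>1 / (2 * pi)\<close> to \<open>1 / 2\<close>
  absorbs the factor 2 of \<open>abs_ln_diff_le\<close>, and the reverse triangle inequality removes
  \<open>y\<close> from the first factor.\<close>

lemma U_star_diff_le:
  assumes "x \<in> sphere 0 1" "x' \<in> sphere 0 1" "y \<in> sphere 0 1" "x \<noteq> y" "x' \<noteq> y"
  shows "\<bar>U_star x y - U_star x' y\<bar>
    \<le> sqrt (norm (x - x')) * (1 / sqrt (norm (x - y)) + 1 / sqrt (norm (x' - y)))"
    (is "_ \<le> _ * ?S")
proof -
  have "U_star x y - U_star x' y = - (1 / (2 * pi)) * (ln (norm (x - y)) - ln (norm (x' - y)))"
    using assms by (simp add: U_star_eq field_simps)
  then have "\<bar>U_star x y - U_star x' y\<bar> = 1 / (2 * pi) * \<bar>ln (norm (x - y)) - ln (norm (x' - y))\<bar>"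
    by (simp add: abs_mult)
  also have "\<dots> \<le> 1 / 2 * (2 * sqrt \<bar>norm (x - y) - norm (x' - y)\<bar> * ?S)"
  proof (rule mult_mono)
    show "1 / (2 * pi) \<le> 1 / 2"
      using pi_gt3 by (simp add: field_simps)
  qed (use abs_ln_diff_le[of "norm (x - y)" "norm (x' - y)"] assms in auto)
  also have "\<dots> = sqrt \<bar>norm (x - y) - norm (x' - y)\<bar> * ?S"
    by simp
  also have "\<dots> \<le> sqrt (norm (x - x')) * ?S"
    using norm_triangle_ineq3[of "x - y" "x' - y"]
    by (intro mult_right_mono) auto
  finally show ?thesis .
qed

text \<open>Compare \<open>ln d\<close> with \<open>ln 1\<close>: on the sphere
  \<open>d \<le> 2\<close>, so \<open>sqrt \<bar>d - 1\<bar> \<le> 1\<close>. The diagonal is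
  covered because \<open>ln 0 = 0\<close> and \<open>1 / 0 = 0\<close>.\<close>

lemma abs_U_star_le:
  assumes "x \<in> sphere 0 1" "y \<in> sphere 0 1"
  shows "\<bar>U_star x y\<bar> \<le> 1 + 1 / sqrt (norm (x - y))"
proof (cases "x = y")
  case True
  then have "x \<bullet> y = 1"
    using assms by (auto simp: dot_square_norm)
  then show ?thesis
    by (simp add: U_star_def)
next
  case False
  define d where "d = norm (x - y)"
  define u where "u = 1 / sqrt d"
  have d: "0 < d" "d \<le> 2"
    using False assms norm_triangle_ineq4[of x y] by (auto simp: d_def)
  then have u: "0 \<le> u"
    by (simp add: u_def)
  have "\<bar>ln d\<bar> \<le> 2 * sqrt \<bar>d - 1\<bar> * (u + 1)"
    using abs_ln_diff_le[of d 1] d by (simp add: u_def)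
  also have "\<dots> \<le> 2 * 1 * (u + 1)"
    using d u by (intro mult_right_mono mult_left_mono) auto
  finally have "\<bar>ln d\<bar> \<le> 2 * (u + 1)"
    by simp
  moreover have "0 \<le> ln (2 :: real)" "ln (2 :: real) \<le> 1"
    using ln_le_minus_one[of "2 :: real"] by simp_all
  \<comment> \<open>The triangle inequality gives \<open>4 * (u + 1) + 1\<close>; the generous 12 is
    chosen to lie below \<open>4 * pi\<close>.\<close>
  ultimately have "\<bar>2 * ln d - ln 2\<bar> \<le> 12 * (1 + u)"
    using u abs_triangle_ineq4[of "2 * ln d" "ln 2"] by (simp add: abs_mult)
  also have "\<dots> \<le> 4 * pi * (1 + u)"
    using u pi_gt3 by (intro mult_right_mono) auto
  finally have "1 / (4 * pi) * \<bar>2 * ln d - ln 2\<bar> \<le> 1 + u"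
    by (simp add: field_simps)
  then show ?thesis
    using U_star_eq[OF assms False] by (simp add: abs_mult d_def u_def)
qed

section \<open>Points of the curve are limits of points off the curve\<close>

text \<open>This makes limits along the complement of the curve unique, so that \<open>Lim\<close>
  in \<open>single_layer_trace\<close> is determined by convergence.\<close>

lemma sphere_diff_curve_nontrivial:
  fixes \<gamma> :: "real \<Rightarrow> 'a :: euclidean_space"
  assumes dim: "2 < DIM('a)" and diff: "\<And>t. \<gamma> differentiable (at t)"
    and x: "x \<in> sphere 0 1" "x \<in> range \<gamma>"
  shows "at x within (sphere 0 1 - range \<gamma>) \<noteq> bot"
proof
  assume "at x within (sphere 0 1 - range \<gamma>) = bot"
  then have "\<not> x islimpt (sphere 0 1 - range \<gamma>)"
    by (simp add: trivial_limit_within)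
  then obtain e where e: "0 < e"
    "\<And>y. y \<in> sphere 0 1 \<Longrightarrow> dist y x < e \<Longrightarrow> y \<in> range \<gamma>"
    using x(2) by (force simp: islimpt_approachable)
  text \<open>A relative neighbourhood of \<open>x\<close> contained in the curve would span an open cone,
    yet the cone over the curve is a differentiable image of a plane.\<close>
  define U where "U = - {0} \<inter> (\<lambda>y. y /\<^sub>R norm y) -` ball x e"
  define cone where "cone = range (\<lambda>p :: real \<times> real. fst p *\<^sub>R \<gamma> (snd p))"
  have "(\<lambda>p. fst p *\<^sub>R \<gamma> (snd p)) differentiable (at p)" for p :: "real \<times> real"
  proof (rule differentiable_scaleR)
    show "fst differentiable (at p)"
      by (intro bounded_linear_imp_differentiable bounded_linear_fst)
    have "(\<gamma> \<circ> snd) differentiable (at p)"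
      by (intro differentiable_chain_at diff bounded_linear_imp_differentiable bounded_linear_snd)
    then show "(\<lambda>p. \<gamma> (snd p)) differentiable (at p)"
      by (simp add: o_def)
  qed
  then have "negligible cone"
    using dim unfolding cone_def
    by (intro negligible_differentiable_image_lowdim)
       (auto simp: differentiable_on_def intro: differentiable_at_withinI)
  moreover have "U \<subseteq> cone"
  proof
    fix y assume "y \<in> U"
    then have y: "y \<noteq> 0" "y /\<^sub>R norm y \<in> range \<gamma>"
      using e(2)[of "y /\<^sub>R norm y"] by (auto simp: U_def dist_commute)
    then obtain t where t: "y /\<^sub>R norm y = \<gamma> t"
      by blast
    have "y = norm y *\<^sub>R \<gamma> t"
      using y(1) by (simp flip: t)
    then show "y \<in> cone"
      unfolding cone_def by (intro range_eqI[of _ _ "(norm y, t)"]) simp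
  qed
  moreover have "open U"
    unfolding U_def by (intro continuous_open_preimage continuous_intros) auto
  moreover have "x \<in> U"
    using x e by (auto simp: U_def)
  ultimately show False
    using open_not_negligible negligible_subset by blast
qed

section \<open>Hoelder continuity of the single layer potential on the sphere\<close>

text \<open>The pointwise kernel bounds are integrated against a bounded weight, with
  \<open>K\<close> controlling the singular factor uniformly in \<open>x\<close>. Points on and off
  the curve are treated alike, so continuity across the curve needs no separate argument.\<close>

lemma single_layer_sphere:
  assumes param: "C2_simple_closed_param \<gamma> C" and C: "C \<subseteq> sphere 0 1"
    and \<sigma>: "continuous_on C \<sigma>"
  shows curve_integrable_single_layer:
      "x \<in> sphere 0 1 \<Longrightarrow> curve_integrable \<gamma> C (\<lambda>y. U_star x y * \<sigma> y)"
    and continuous_on_single_layer: "continuous_on (sphere 0 1) (single_layer \<gamma> \<sigma>)"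
proof -
  define \<gamma>' where "\<gamma>' = (\<lambda>t. vector_derivative \<gamma> (at t))"
  have loop: "loop_free \<gamma>" and image: "\<gamma> ` {0..1} = C" and per: "\<And>t. \<gamma> (t + 1) = \<gamma> t"
    and deriv: "\<And>t. (\<gamma> has_vector_derivative \<gamma>' t) (at t)"
    and cont': "continuous_on UNIV \<gamma>'" and reg: "\<And>t. \<gamma>' t \<noteq> 0"
    using param by (auto simp: C2_simple_closed_param_def simple_path_def path_image_def
        C1_differentiable_on_eq \<gamma>'_def vector_derivative_works)
  have cont: "continuous_on S \<gamma>" for S
    using deriv by (meson continuous_at_imp_continuous_on has_vector_derivative_continuous)
  obtain c where c: "0 < c" "\<And>s t. s \<in> {0..1} \<Longrightarrow> t \<in> {0..1} \<Longrightarrow>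
      c * min \<bar>s - t\<bar> (1 - \<bar>s - t\<bar>) \<le> norm (\<gamma> s - \<gamma> t)"
    using chord_arc_closed_curve[OF deriv cont' reg per loop] by metis
  define J where "J = (\<lambda>x t. 1 / sqrt (norm (x - \<gamma> t)))"
  define K where "K = 24 * sqrt (2 / c)"
  have fin: "finite {t \<in> {0..1}. \<gamma> t = x}" and J: "J x integrable_on {0..1}" "integral {0..1} (J x) \<le> K" for x
    using inverse_sqrt_dist_curve_integral_bounded[OF cont c] by (auto simp: J_def K_def)
  \<comment> \<open>Density and speed are merged into one weight, which enters the estimates only
    through its bound \<open>M\<close>.\<close>
  define w where "w = (\<lambda>t. \<sigma> (\<gamma> t) * norm (\<gamma>' t))"
  define f where "f = (\<lambda>x t. U_star x (\<gamma> t) * \<sigma> (\<gamma> t) * norm (\<gamma>' t))"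
  have f_eq: "f x t = U_star x (\<gamma> t) * w t" for x t
    by (simp add: f_def w_def)
  have w_cont: "continuous_on {0..1} w"
    unfolding w_def
    by (intro continuous_intros continuous_on_compose2[OF \<sigma> cont] continuous_on_subset[OF cont'])
       (auto simp: image[symmetric])
  then have "bounded (w ` {0..1})"
    by (intro compact_imp_bounded compact_continuous_image) auto
  then obtain M where M: "0 < M" "\<And>t. t \<in> {0..1} \<Longrightarrow> \<bar>w t\<bar> \<le> M"
    unfolding bounded_pos by auto
  have sphere: "\<gamma> t \<in> sphere 0 1" if "t \<in> {0..1}" for t
    using that C image by blast
  have param_set: "{t \<in> {0..1}. \<gamma> t \<in> C} = {0..1}"
    using image by auto
  have f_int: "f x absolutely_integrable_on {0..1}" if x: "x \<in> sphere 0 1" for x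
  proof (rule measurable_bounded_by_integrable_imp_absolutely_integrable)
    have "\<gamma> \<in> borel_measurable (lebesgue_on {0..1})" "w \<in> borel_measurable (lebesgue_on {0..1})"
      using cont w_cont by (intro continuous_imp_measurable_on_sets_lebesgue; simp)+
    then show "f x \<in> borel_measurable (lebesgue_on {0..1})"
      unfolding f_eq U_star_def by measurable
    show "(\<lambda>t. (1 + J x t) * M) integrable_on {0..1}"
      using J(1)[of x] by (intro integrable_on_mult_left integrable_add) auto
    \<comment> \<open>This holds even where \<open>\<gamma> t = x\<close>, since
      \<open>abs_U_star_le\<close> includes the diagonal.\<close>
    show "norm (f x t) \<le> (1 + J x t) * M" if "t \<in> {0..1}" for t
      unfolding f_eq norm_mult J_def real_norm_def abs_mult
      using that x sphere M by (intro mult_mono abs_U_star_le) auto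
  qed auto
  then show "curve_integrable \<gamma> C (\<lambda>y. U_star x y * \<sigma> y)" if "x \<in> sphere 0 1" for x
    using that unfolding curve_integrable_def param_set by (simp add: f_def \<gamma>'_def)
  have single_layer: "single_layer \<gamma> \<sigma> x = integral {0..1} (f x)" for x
    unfolding single_layer_def curve_integral_def path_image_def image param_set
    by (simp add: f_def \<gamma>'_def)
  have hoelder: "\<bar>single_layer \<gamma> \<sigma> x - single_layer \<gamma> \<sigma> x'\<bar> \<le> 2 * K * M * sqrt (dist x x')"
    if x: "x \<in> sphere 0 1" and x': "x' \<in> sphere 0 1" for x x'
  proof -
    \<comment> \<open>These are the parameters at which \<open>U_star_diff_le\<close> does not
      apply. They are finitely many, so on them \<open>H'\<close> can take the value to be dominated
      without changing the integral.\<close>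
    define N where "N = {t \<in> {0..1}. \<gamma> t = x} \<union> {t \<in> {0..1}. \<gamma> t = x'}"
    define H where "H = (\<lambda>t. sqrt (norm (x - x')) * (J x t + J x' t) * M)"
    define H' where "H' = (\<lambda>t. if t \<in> N then norm (f x t - f x' t) else H t)"
    define I where "I = sqrt (norm (x - x')) * (integral {0..1} (J x) + integral {0..1} (J x')) * M"
    have "(H has_integral I) {0..1}"
      unfolding H_def I_def using J(1)
      by (intro has_integral_mult_left has_integral_mult_right has_integral_add integrable_integral)
    then have H': "(H' has_integral I) {0..1}"
      by (rule has_integral_spike_finite[rotated 2, of _ _ _ N]) (use fin in \<open>auto simp: H'_def N_def\<close>)
    have fx: "f x integrable_on {0..1}" "f x' integrable_on {0..1}"
      using f_int x x' set_lebesgue_integral_eq_integral(1) by blast+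
    have "norm (integral {0..1} (\<lambda>t. f x t - f x' t)) \<le> integral {0..1} H'"
    proof (rule integral_norm_bound_integral)
      show "(\<lambda>t. f x t - f x' t) integrable_on {0..1}"
        using fx by (rule integrable_diff)
      show "H' integrable_on {0..1}"
        using H' by blast
      show "norm (f x t - f x' t) \<le> H' t" if t: "t \<in> {0..1}" for t
      proof (cases "t \<in> N")
        case False
        have "norm (f x t - f x' t) = \<bar>U_star x (\<gamma> t) - U_star x' (\<gamma> t)\<bar> * \<bar>w t\<bar>"
          by (simp add: f_eq left_diff_distrib[symmetric] abs_mult)
        also have "\<dots> \<le> H t"
          unfolding H_def J_def using False t x x' sphere M
          by (intro mult_mono U_star_diff_le) (auto simp: N_def)
        finally show ?thesis
          using False by (simp add: H'_def)
      qed (simp add: H'_def)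
    qed
    also have "integral {0..1} H' = I"
      using H' by (rule integral_unique)
    also have "I \<le> sqrt (norm (x - x')) * (K + K) * M"
      unfolding I_def using J(2) M(1) by (intro mult_right_mono mult_left_mono add_mono) auto
    finally show ?thesis
      using fx by (simp add: single_layer integral_diff dist_norm mult_ac)
  qed
  show "continuous_on (sphere 0 1) (single_layer \<gamma> \<sigma>)"
    unfolding continuous_on_def
  proof
    fix x :: "real ^ 3" assume x: "x \<in> sphere 0 1"
    have "((\<lambda>x'. 2 * K * M * sqrt (dist x' x)) \<longlongrightarrow> 2 * K * M * sqrt (dist x x)) (at x within sphere 0 1)"
      by (intro tendsto_intros)
    then have "((\<lambda>x'. 2 * K * M * sqrt (dist x' x)) \<longlongrightarrow> 0) (at x within sphere 0 1)"
      by simp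
    then have "((\<lambda>x'. single_layer \<gamma> \<sigma> x' - single_layer \<gamma> \<sigma> x) \<longlongrightarrow> 0) (at x within sphere 0 1)"
      by (rule Lim_null_comparison[rotated])
         (use hoelder x in \<open>auto simp: eventually_at_filter\<close>)
    then show "(single_layer \<gamma> \<sigma> \<longlongrightarrow> single_layer \<gamma> \<sigma> x) (at x within sphere 0 1)"
      by (simp add: LIM_zero_iff)
  qed
qed

section \<open>The weakly singular integral as a limit of truncated integrals\<close>

text \<open>Dominated convergence with majorant \<open>norm (h t)\<close>: a parameter with
  \<open>\<gamma> t \<noteq> x\<close> eventually leaves the shrinking ball. Where
  \<open>\<gamma> t = x\<close> the truncated integrands are 0, and \<open>f x = 0\<close> makes
  this the right limit.\<close>

lemma curve_integral_diff_ball_tendsto: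
  assumes cont: "continuous_on {0..1} \<gamma>"
    and int: "curve_integrable \<gamma> C f" and meas: "{t \<in> {0..1}. \<gamma> t \<in> C} \<in> sets lebesgue"
    and x: "f x = 0"
  shows "((\<lambda>\<epsilon>. curve_integral \<gamma> (C - ball x \<epsilon>) f) \<longlongrightarrow> curve_integral \<gamma> C f) (at_right 0)"
\<comment> \<open>Dominated convergence is about sequences, so the one-sided limit is tested along
  sequences of radii.\<close>
proof (rule tendsto_at_right_sequentially[of 0 1])
  fix \<epsilon> :: "nat \<Rightarrow> real"
  assume pos: "\<And>n. 0 < \<epsilon> n" and lim: "\<epsilon> \<longlonglongrightarrow> 0"
  define S where "S = {t \<in> {0..1}. \<gamma> t \<in> C}"
  define h where "h = (\<lambda>t. f (\<gamma> t) * norm (vector_derivative \<gamma> (at t)))"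
  define E where "E n = {0..1} \<inter> \<gamma> -` (- ball x (\<epsilon> n))" for n
  have h: "h absolutely_integrable_on S"
    using int by (simp add: curve_integrable_def h_def S_def)
  have "closed (E n)" for n
    unfolding E_def using cont by (intro continuous_closed_preimage) auto
  then have E: "E n \<in> sets lebesgue" for n
    by simp
  have eq: "{t \<in> {0..1}. \<gamma> t \<in> C - ball x (\<epsilon> n)} = E n \<inter> S" for n
    by (auto simp: E_def S_def)
  have "(\<lambda>n. integral S (\<lambda>t. if t \<in> E n then h t else 0)) \<longlonglongrightarrow> integral S h"
  proof (rule dominated_convergence)
    show "(\<lambda>t. if t \<in> E n then h t else 0) integrable_on S" for n
      unfolding integrable_restrict_Int
      using set_integrable_subset[OF h, of "E n \<inter> S"] E meas
      by (auto simp: S_def intro: set_lebesgue_integral_eq_integral(1))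
    show "(\<lambda>t. norm (h t)) integrable_on S"
      using h by (auto simp: absolutely_integrable_on_def)
    show "(\<lambda>n. if t \<in> E n then h t else 0) \<longlonglongrightarrow> h t" if t: "t \<in> S" for t
    proof (cases "\<gamma> t = x")
      case True
      then show ?thesis
        using x by (simp add: h_def cong: if_cong)
    next
      case False
      then have "eventually (\<lambda>n. \<epsilon> n < dist x (\<gamma> t)) sequentially"
        by (intro order_tendstoD[OF lim]) auto
      then have "eventually (\<lambda>n. (if t \<in> E n then h t else 0) = h t) sequentially"
        by eventually_elim (use t in \<open>auto simp: E_def S_def\<close>)
      then show ?thesis
        by (rule tendsto_eventually)
    qed
  qed auto
  then show "(\<lambda>n. curve_integral \<gamma> (C - ball x (\<epsilon> n)) f) \<longlonglongrightarrow> curve_integral \<gamma> C f"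
    unfolding curve_integral_def eq integral_restrict_Int by (simp add: h_def S_def)
qed simp

section \<open>Existence of the trace and continuity across the curve\<close>

text \<open>The limit over shrinking balls expresses that the integral is weakly singular, and the
  nontrivial filter ensures that the trace is a genuine, unique limit. Everything follows from
  continuity of \<open>single_layer\<close> on the whole sphere: its value on the curve is the line
  integral itself.\<close>

theorem lemma3p1:
  fixes \<gamma> :: "real \<Rightarrow> real ^ 3" and C :: "(real ^ 3) set" and \<sigma> :: "real ^ 3 \<Rightarrow> real"
  assumes "C2_simple_closed_param \<gamma> C"
    and "C \<subseteq> sphere 0 1"
    and "continuous_on C \<sigma>"
  shows "(\<forall>x0\<in>C.
            curve_integrable \<gamma> C (\<lambda>y. U_star x0 y * \<sigma> y) \<and>
            ((\<lambda>\<epsilon>. curve_integral \<gamma> (C - ball x0 \<epsilon>) (\<lambda>y. U_star x0 y * \<sigma> y))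
               \<longlongrightarrow> curve_integral \<gamma> C (\<lambda>y. U_star x0 y * \<sigma> y)) (at_right 0) \<and>
            at x0 within (sphere 0 1 - C) \<noteq> bot \<and>
            (single_layer \<gamma> \<sigma> \<longlongrightarrow> single_layer_trace \<gamma> \<sigma> x0) (at x0 within (sphere 0 1 - C)) \<and>
            single_layer_trace \<gamma> \<sigma> x0 = curve_integral \<gamma> C (\<lambda>y. U_star x0 y * \<sigma> y)) \<and>
         continuous_on (sphere 0 1)
           (\<lambda>x. if x \<in> C then single_layer_trace \<gamma> \<sigma> x else single_layer \<gamma> \<sigma> x)"
proof -
  have image: "path_image \<gamma> = C" and diff: "\<And>t. \<gamma> differentiable (at t)"
    and per: "\<And>t. \<gamma> (t + 1) = \<gamma> t"
    using assms(1) by (auto simp: C2_simple_closed_param_def C1_differentiable_on_eq)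
  have cont: "continuous_on {0..1} \<gamma>"
    using diff by (intro continuous_at_imp_continuous_on ballI differentiable_imp_continuous_within)
  \<comment> \<open>\<open>sphere_diff_curve_nontrivial\<close> removes the image of the whole line;
    periodicity identifies it with the image of the unit interval.\<close>
  have range: "range \<gamma> = C"
  proof -
    interpret periodic_fun_simple' \<gamma>
      by unfold_locales (rule per)
    have "\<gamma> t \<in> \<gamma> ` {0..1}" for t
    proof
      show "\<gamma> t = \<gamma> (frac t)"
        using plus_of_int[of "frac t" "\<lfloor>t\<rfloor>"] by (simp add: frac_def)
      show "frac t \<in> {0..1}"
        using frac_lt_1[of t] by simp
    qed
    then show ?thesis
      using image by (auto simp: path_image_def)
  qed
  have layer_eq: "single_layer \<gamma> \<sigma> x = curve_integral \<gamma> C (\<lambda>y. U_star x y * \<sigma> y)" for x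
    by (simp add: single_layer_def image)
  have lim: "(single_layer \<gamma> \<sigma> \<longlongrightarrow> single_layer \<gamma> \<sigma> x) (at x within (sphere 0 1 - C))"
    if "x \<in> C" for x
    using continuous_on_single_layer[OF assms] that assms(2)
    by (auto simp: continuous_on_def intro: tendsto_within_subset)
  have nontrivial: "at x within (sphere 0 1 - C) \<noteq> bot" if "x \<in> C" for x
    using sphere_diff_curve_nontrivial[of \<gamma> x] diff that assms(2) by (auto simp: range)
  have trace: "single_layer_trace \<gamma> \<sigma> x = single_layer \<gamma> \<sigma> x" if "x \<in> C" for x
    using tendsto_Lim[OF nontrivial lim] that by (simp add: single_layer_trace_def image)
  have "((\<lambda>\<epsilon>. curve_integral \<gamma> (C - ball x \<epsilon>) (\<lambda>y. U_star x y * \<sigma> y))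
               \<longlongrightarrow> curve_integral \<gamma> C (\<lambda>y. U_star x y * \<sigma> y)) (at_right 0)" if "x \<in> C" for x
  proof (rule curve_integral_diff_ball_tendsto[OF cont])
    show "curve_integrable \<gamma> C (\<lambda>y. U_star x y * \<sigma> y)"
      using curve_integrable_single_layer[OF assms] that assms(2) by blast
    have "{t \<in> {0..1}. \<gamma> t \<in> C} = {0..1}"
      using range by auto
    then show "{t \<in> {0..1}. \<gamma> t \<in> C} \<in> sets lebesgue"
      by simp
    \<comment> \<open>The default \<open>ln 0 = 0\<close> supplies the vanishing on the diagonal
      that the truncation lemma asks for.\<close>
    have "x \<bullet> x = 1"
      using that assms(2) by (auto simp: dot_square_norm)
    then show "U_star x x * \<sigma> x = 0"
      by (simp add: U_star_def)
  qed
  moreover have "continuous_on (sphere 0 1)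
      (\<lambda>x. if x \<in> C then single_layer_trace \<gamma> \<sigma> x else single_layer \<gamma> \<sigma> x)"
    using continuous_on_single_layer[OF assms] by (simp add: trace cong: if_cong)
  ultimately show ?thesis
    using curve_integrable_single_layer[OF assms] assms(2) nontrivial lim trace layer_eq by auto
qed

end
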